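(* Let $\lambda$ be a nonzero real number and let $m,n\ge 0$ be integers. Then \[ \phi_{m+n,\lambda}(x)=\sum_{j=0}^{m}\sum_{k=0}^{n}\binom{n}{k}{m \brace j}_{\lambda}(j-m\lambda)_{n-k,\lambda}\,x^{j}\,\phi_{k,\lambda}(x). \] In particular, setting $x=1$, \[ \phi_{m+n,\lambda}=\sum_{j=0}^{m}\sum_{k=0}^{n}\binom{n}{k}{m \brace j}_{\lambda}(j-m\lambda)_{n-k,\lambda}\,\phi_{k,\lambda}, \] where $\phi_{n,\lambda}=\phi_{n,\lambda}(1)$ are the degenerate Bell numbers.
   Context: For nonzero real $\lambda$, the degenerate falling factorial is $(x)_{0,\lambda}=1$, $(x)_{n,\lambda}=x(x-\lambda)(x-2\lambda)\cdots(x-(n-1)\lambda)$ for $n\ge1$. The degenerate exponentials are the formal power series $e_\lambda^{x}(t)=\sum_{n\ge0}(x)_{n,\lambda}\frac{t^n}{n!}$ and $e_\lambda(t)=e_\lambda^{1}(t)$. The degenerate Stirling numbers of the second kind ${n\brace k}_\lambda$ are defined by $(x)_{n,\lambda}=\sum_{k=0}^n {n\brace k}_\lambda (x)_k$, with $(x)_k=x(x-1)\cdots(x-k+1)$, $(x)_0=1$. The degenerate Bell polynomials $\phi_{n,\lambda}(x)$ are defined by $e^{x(e_\lambda(t)-1)}=\sum_{n\ge0}\phi_{n,\lambda}(x)\frac{t^n}{n!}$; equivalently $\phi_{n,\lambda}(x)=\sum_{k=0}^n {n\brace k}_\lambda x^k$. *)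

theory Defs
  imports Complex_Main "HOL-Computational_Algebra.Formal_Power_Series"
begin

text \<open>
  The degeneration parameter \<open>\<lambda>\<close> is written \<open>l\<close>.
\<close>

definition degen_ffact :: "real \<Rightarrow> real \<Rightarrow> nat \<Rightarrow> real" where
  "degen_ffact l x n = (\<Prod>i<n. x - real i * l)"

definition falling_fact :: "real \<Rightarrow> nat \<Rightarrow> real" where
  "falling_fact x n = (\<Prod>i<n. x - real i)"

text \<open>
  The series \<open>e\<^sub>\<lambda>\<^sup>x(t)\<close> in the indeterminate \<open>t\<close>; the exponent \<open>x\<close> is a real number.
\<close>

definition degen_exp :: "real \<Rightarrow> real \<Rightarrow> real fps" where
  "degen_exp l x = Abs_fps (\<lambda>n. degen_ffact l x n / fact n)"

text \<open>
  The row \<open>k \<mapsto> degen_Stirling2 l n k\<close> is the unique family of coefficients expressing the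
  degenerate falling factorial in the falling factorial basis. Since the defining sum stops at
  \<open>n\<close>, the entries with \<open>k > n\<close> are fixed to be zero. Existence and uniqueness are proved in
  \<open>degen_Stirling2_ex1\<close>.
\<close>

definition degen_Stirling2 :: "real \<Rightarrow> nat \<Rightarrow> nat \<Rightarrow> real" where
  "degen_Stirling2 l n =
     (THE S. (\<forall>k>n. S k = 0) \<and>
             (\<forall>x. degen_ffact l x n = (\<Sum>k\<le>n. S k * falling_fact x k)))"

text \<open>
  The value at \<open>x\<close> of the degenerate Bell polynomial, read off from
  \<open>exp (x (e\<^sub>\<lambda>(t) - 1)) = (\<Sum>n. degen_Bell l n x * t ^ n / n!)\<close>. The inner series has zero
  constant term, so the composition \<open>oo\<close> is the genuine substitution.
\<close>

definition degen_Bell :: "real \<Rightarrow> nat \<Rightarrow> real \<Rightarrow> real" where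
  "degen_Bell l n x =
     fact n * fps_nth (fps_exp 1 oo (fps_const x * (degen_exp l 1 - 1))) n"

definition degen_Bell_number :: "real \<Rightarrow> nat \<Rightarrow> real" where
  "degen_Bell_number l n = degen_Bell l n 1"

lemma falling_fact_less: "j < k \<Longrightarrow> falling_fact (real j) k = 0"
  unfolding falling_fact_def by (rule prod_zero) auto

lemma falling_fact_diag: "falling_fact (real j) j \<noteq> 0"
  unfolding falling_fact_def by (auto simp: prod_zero_iff)

lemma falling_fact_coeffs_unique:
  assumes eq: "\<And>x. (\<Sum>k\<le>n. S k * falling_fact x k) = (\<Sum>k\<le>n. T k * falling_fact x k)"
    and "k \<le> n"
  shows "S k = T k"
  using \<open>k \<le> n\<close>
proof (induction k rule: less_induct)
  case (less j)
  have split: "(\<Sum>k\<le>n. U k * falling_fact (real j) k) =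
      (\<Sum>k<j. U k * falling_fact (real j) k) + U j * falling_fact (real j) j" for U
  proof -
    have "(\<Sum>k\<le>n. U k * falling_fact (real j) k) = (\<Sum>k\<le>j. U k * falling_fact (real j) k)"
      using less.prems by (intro sum.mono_neutral_right) (auto simp: falling_fact_less)
    then show ?thesis
      by (simp add: lessThan_Suc_atMost[symmetric])
  qed
  have "(\<Sum>k<j. S k * falling_fact (real j) k) = (\<Sum>k<j. T k * falling_fact (real j) k)"
    using less by (intro sum.cong) auto
  then have "S j * falling_fact (real j) j = T j * falling_fact (real j) j"
    using eq[of "real j"] by (simp add: split)
  then show ?case
    using falling_fact_diag by simp
qed

lemma degen_Stirling2_exists:
  "\<exists>S. (\<forall>k>n. S k = 0) \<and> (\<forall>x. degen_ffact l x n = (\<Sum>k\<le>n. S k * falling_fact x k))"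
proof (induction n)
  case 0
  show ?case
    by (rule exI[of _ "\<lambda>k. if k = 0 then 1 else 0"]) (simp add: degen_ffact_def falling_fact_def)
next
  case (Suc n)
  then obtain S where S0: "\<And>k. k > n \<Longrightarrow> S k = 0"
    and S: "\<And>x. degen_ffact l x n = (\<Sum>k\<le>n. S k * falling_fact x k)"
    by blast
  define T where "T k = (if k = 0 then 0 else S (k - 1)) + (real k - real n * l) * S k" for k
  have "degen_ffact l x (Suc n) = (\<Sum>k\<le>Suc n. T k * falling_fact x k)" for x
  proof -
    have "degen_ffact l x (Suc n) = (\<Sum>k\<le>n. S k * falling_fact x k) * (x - real n * l)"
      by (simp add: degen_ffact_def S[unfolded degen_ffact_def])
    also have "\<dots> = (\<Sum>k\<le>n. S k * falling_fact x (Suc k)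
        + (real k - real n * l) * S k * falling_fact x k)"
      unfolding sum_distrib_right
      by (intro sum.cong) (auto simp: falling_fact_def algebra_simps)
    also have "\<dots> = (\<Sum>k\<le>n. S k * falling_fact x (Suc k))
        + (\<Sum>k\<le>Suc n. (real k - real n * l) * S k * falling_fact x k)"
      by (simp add: sum.distrib S0)
    also have "(\<Sum>k\<le>n. S k * falling_fact x (Suc k))
        = (\<Sum>k\<le>Suc n. (if k = 0 then 0 else S (k - 1)) * falling_fact x k)"
      by (subst sum.atMost_Suc_shift) simp
    finally show ?thesis
      by (simp only: T_def sum.distrib[symmetric] distrib_right)
  qed
  moreover have "\<forall>k>Suc n. T k = 0"
    by (simp add: T_def S0)
  ultimately show ?case
    by blast
qed

lemma degen_Stirling2_ex1:
  "\<exists>!S. (\<forall>k>n. S k = 0) \<and> (\<forall>x. degen_ffact l x n = (\<Sum>k\<le>n. S k * falling_fact x k))"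
proof (rule ex_ex1I[OF degen_Stirling2_exists])
  fix S T :: "nat \<Rightarrow> real"
  assume S: "(\<forall>k>n. S k = 0) \<and> (\<forall>x. degen_ffact l x n = (\<Sum>k\<le>n. S k * falling_fact x k))"
    and T: "(\<forall>k>n. T k = 0) \<and> (\<forall>x. degen_ffact l x n = (\<Sum>k\<le>n. T k * falling_fact x k))"
  have "S k = T k" for k
  proof (cases "k \<le> n")
    case True
    have "(\<Sum>k\<le>n. S k * falling_fact x k) = (\<Sum>k\<le>n. T k * falling_fact x k)" for x
      using S T by metis
    then show ?thesis
      using True by (rule falling_fact_coeffs_unique)
  next
    case False
    then show ?thesis
      using S T by simp
  qed
  then show "S = T" by blast
qed

lemma degen_Stirling2_eq_0: "k > n \<Longrightarrow> degen_Stirling2 l n k = 0"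
  and degen_ffact_eq_sum_Stirling2:
    "degen_ffact l x n = (\<Sum>k\<le>n. degen_Stirling2 l n k * falling_fact x k)"
  using theI'[OF degen_Stirling2_ex1[of n l]] unfolding degen_Stirling2_def by blast+

end

(*
  With B = exp (x (e_l(t) - 1)) we have B' = x e_l^(1 - l) B, so the recurrence for the degenerate
  Stirling numbers turns into the closed form
    B^(m) = (sum over j of S(m,j) x^j e_l^(j - m l)) B.
  Since B^(m) has exponential generating coefficients phi_(m+n), the identity follows by comparing
  the coefficients of t^n.
*)
theory Submission
  imports Defs
begin

text \<open>Differentiation is the left shift on exponential generating coefficients, so an index
  sum \<open>m + n\<close> can be split into m derivatives and the coefficient at n.\<close>

lemma fps_nth_fps_nth_deriv:
  fixes f :: "'a::field_char_0 fps"
  shows "fact n * fps_nth (fps_nth_deriv m f) n = fact (m + n) * fps_nth f (m + n)"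
proof (induction m arbitrary: f)
  case (Suc m)
  have "fact n * fps_nth (fps_nth_deriv (Suc m) f) n = fact (m + n) * fps_nth (fps_deriv f) (m + n)"
    by (simp add: Suc)
  also have "\<dots> = fact (Suc m + n) * fps_nth f (Suc m + n)"
    by (simp add: algebra_simps)
  finally show ?case .
qed simp

text \<open>Write x - c = (x - k) + (k - c); the first summand is the next factor of the falling
  factorial.\<close>

lemma falling_fact_mult_shift:
  "falling_fact x k * (x - c) = falling_fact x (Suc k) + (real k - c) * falling_fact x k"
  by (simp add: falling_fact_def algebra_simps)

lemma degen_ffact_Suc: "degen_ffact l x (Suc n) = degen_ffact l x n * (x - real n * l)"
  by (simp add: degen_ffact_def)

lemma degen_ffact_Suc_left: "degen_ffact l x (Suc n) = x * degen_ffact l (x - l) n"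
  unfolding degen_ffact_def prod.lessThan_Suc_shift by (simp add: algebra_simps)

text \<open>Pulling \<open>l\<close> out of every factor leaves an ordinary falling factorial of
  \<open>x / l\<close>, which links the degenerate exponential to the binomial series.\<close>

lemma degen_ffact_conv_gbinomial:
  assumes "l \<noteq> 0"
  shows "degen_ffact l x n = fact n * (x / l gchoose n) * l ^ n"
proof -
  have "degen_ffact l x n = (\<Prod>i<n. (x / l - real i) * l)"
    using assms by (simp add: degen_ffact_def algebra_simps)
  also have "\<dots> = fact n * (x / l gchoose n) * l ^ n"
    by (simp add: prod.distrib gbinomial_prod_rev atLeast0LessThan)
  finally show ?thesis .
qed

text \<open>Multiply the expansion of \<open>degen_ffact l x n\<close> by x - n l, rewrite each
  product with \<open>falling_fact_mult_shift\<close>, and compare coefficients in the falling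
  factorial basis.\<close>

lemma degen_Stirling2_Suc:
  "degen_Stirling2 l (Suc n) k =
     (if k = 0 then 0 else degen_Stirling2 l n (k - 1)) + (real k - real n * l) * degen_Stirling2 l n k"
proof (cases "k \<le> Suc n")
  case True
  define S where "S = degen_Stirling2 l n"
  define T where "T k = (if k = 0 then 0 else S (k - 1)) + (real k - real n * l) * S k" for k
  \<comment> \<open>This default value lets the unshifted sum below run up to \<open>Suc n\<close>
    as well.\<close>
  have S0: "S (Suc n) = 0"
    by (simp add: S_def degen_Stirling2_eq_0)
  have "(\<Sum>k\<le>Suc n. degen_Stirling2 l (Suc n) k * falling_fact x k)
      = (\<Sum>k\<le>Suc n. T k * falling_fact x k)" for x
  proof -
    have "(\<Sum>k\<le>Suc n. degen_Stirling2 l (Suc n) k * falling_fact x k)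
        = (\<Sum>k\<le>n. S k * (falling_fact x k * (x - real n * l)))"
      by (simp only: degen_ffact_eq_sum_Stirling2[symmetric] degen_ffact_Suc)
        (simp add: degen_ffact_eq_sum_Stirling2[of l x n] S_def sum_distrib_right mult.assoc)
    also have "\<dots> = (\<Sum>k\<le>n. S k * falling_fact x (Suc k))
        + (\<Sum>k\<le>n. (real k - real n * l) * S k * falling_fact x k)"
      unfolding falling_fact_mult_shift by (simp add: algebra_simps flip: sum.distrib)
    also have "(\<Sum>k\<le>n. (real k - real n * l) * S k * falling_fact x k)
        = (\<Sum>k\<le>Suc n. (real k - real n * l) * S k * falling_fact x k)"
      by (simp add: S0)
    also have "(\<Sum>k\<le>n. S k * falling_fact x (Suc k))
        = (\<Sum>k\<le>Suc n. (if k = 0 then 0 else S (k - 1)) * falling_fact x k)"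
      by (subst sum.atMost_Suc_shift) simp
    finally show ?thesis
      by (simp only: T_def sum.distrib[symmetric] distrib_right)
  qed
  then have "degen_Stirling2 l (Suc n) k = T k"
    using True by (rule falling_fact_coeffs_unique)
  then show ?thesis
    by (simp add: T_def S_def)
qed (simp add: degen_Stirling2_eq_0)

lemma degen_exp_nth [simp]: "fps_nth (degen_exp l x) n = degen_ffact l x n / fact n"
  by (simp add: degen_exp_def)

lemma degen_exp_0 [simp]: "degen_exp l 0 = 1"
proof (rule fps_ext)
  fix n show "fps_nth (degen_exp l 0) n = fps_nth 1 n"
    by (cases n) (simp_all add: degen_ffact_Suc_left, simp add: degen_ffact_def)
qed

text \<open>This is the closed form (1 + l t)^(x/l), with \<open>fps_X\<close> in the role of
  t.\<close>

lemma degen_exp_conv_fps_binomial: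
  assumes "l \<noteq> 0"
  shows "degen_exp l x = fps_binomial (x / l) oo (fps_const l * fps_X)"
  using assms
  by (intro fps_ext) (simp add: fps_compose_linear degen_ffact_conv_gbinomial)

text \<open>The exponent law is inherited from the binomial series, since substituting l t respects
  products.\<close>

lemma degen_exp_add_mult:
  assumes "l \<noteq> 0"
  shows "degen_exp l (x + y) = degen_exp l x * degen_exp l y"
  using assms
  by (simp add: degen_exp_conv_fps_binomial add_divide_distrib fps_binomial_add_mult
      fps_compose_mult_distrib)

text \<open>Peeling the first factor x off each coefficient leaves a product starting at x - l. For
  nonzero \<open>l\<close> this is the power rule for (1 + l t)^(x/l).\<close>

lemma fps_deriv_degen_exp:
  "fps_deriv (degen_exp l x) = fps_const x * degen_exp l (x - l)"
proof (rule fps_ext)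
  fix n
  have "real (Suc n) / fact (Suc n) = 1 / fact n"
    by (simp add: divide_simps)
  then show "fps_nth (fps_deriv (degen_exp l x)) n = fps_nth (fps_const x * degen_exp l (x - l)) n"
    by (simp add: degen_ffact_Suc_left divide_simps del: of_nat_Suc)
qed

definition degen_Bell_egf :: "real \<Rightarrow> real \<Rightarrow> real fps" where
  "degen_Bell_egf l x = fps_exp 1 oo (fps_const x * (degen_exp l 1 - 1))"

lemma degen_Bell_egf_nth: "fps_nth (degen_Bell_egf l x) n = degen_Bell l n x / fact n"
  by (simp add: degen_Bell_def degen_Bell_egf_def)

lemma fps_deriv_degen_Bell_egf:
  "fps_deriv (degen_Bell_egf l x) = fps_const x * degen_exp l (1 - l) * degen_Bell_egf l x"
proof -
  \<comment> \<open>The chain rule for formal composition requires the inner series to have zero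
    constant term.\<close>
  have "fps_nth (fps_const x * (degen_exp l 1 - 1)) 0 = 0"
    by (simp add: degen_ffact_def)
  then show ?thesis
    by (simp add: degen_Bell_egf_def fps_compose_deriv fps_deriv_degen_exp mult_ac)
qed

text \<open>In the product rule, the derivative of the Bell series contributes a factor e_l^(1 - l),
  which the exponent law merges with e_l^y.\<close>

lemma fps_deriv_degen_exp_mult_Bell_egf:
  assumes "l \<noteq> 0"
  shows "fps_deriv (degen_exp l y * degen_Bell_egf l x) =
    (fps_const y * degen_exp l (y - l) + fps_const x * degen_exp l (y + 1 - l)) * degen_Bell_egf l x"
proof -
  have "degen_exp l (y + 1 - l) = degen_exp l y * degen_exp l (1 - l)"
    using degen_exp_add_mult[OF assms, of y "1 - l"] by (simp add: algebra_simps)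
  then show ?thesis
    by (simp add: fps_deriv_degen_exp fps_deriv_degen_Bell_egf algebra_simps)
qed

text \<open>Induction on m: differentiating the j-th term gives multiples of the j-th and (j+1)-st
  terms of the next level, and collecting them reproduces the recurrence
  \<open>degen_Stirling2_Suc\<close>.\<close>

lemma fps_nth_deriv_degen_Bell_egf:
  assumes "l \<noteq> 0"
  shows "fps_nth_deriv m (degen_Bell_egf l x) =
    (\<Sum>j\<le>m. fps_const (degen_Stirling2 l m j * x ^ j)
      * (degen_exp l (real j - real m * l) * degen_Bell_egf l x))"
proof (induction m)
  case 0
  have "degen_Stirling2 l 0 0 = 1"
    using degen_ffact_eq_sum_Stirling2[of l 0 0] by (simp add: degen_ffact_def falling_fact_def)
  then show ?case by simp
next
  case (Suc m)
  define S where "S = degen_Stirling2 l m"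
  \<comment> \<open>\<open>G\<close> already carries the exponent of level \<open>Suc m\<close>: j -
    m l lowered by l is the exponent of \<open>G j\<close>, and one more than that is the exponent
    of \<open>G (Suc j)\<close>.\<close>
  define G where "G j = degen_exp l (real j - real (Suc m) * l) * degen_Bell_egf l x" for j
  have S0: "S (Suc m) = 0"
    by (simp add: S_def degen_Stirling2_eq_0)
  have deriv: "fps_deriv (degen_exp l (real j - real m * l) * degen_Bell_egf l x)
      = fps_const (real j - real m * l) * G j + fps_const x * G (Suc j)" for j
    unfolding fps_deriv_degen_exp_mult_Bell_egf[OF assms] G_def
    by (simp add: algebra_simps)
  have "fps_nth_deriv (Suc m) (degen_Bell_egf l x)
      = (\<Sum>j\<le>m. fps_const (S j * x ^ j)
          * fps_deriv (degen_exp l (real j - real m * l) * degen_Bell_egf l x))"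
    \<comment> \<open>The extra derivative is moved to the outside so that the induction hypothesis
      applies to the inner ones.\<close>
    unfolding fps_nth_deriv_commute Suc.IH S_def[symmetric]
    by (simp add: fps_deriv_sum del: fps_deriv_mult)
  also have "\<dots> = (\<Sum>j\<le>m. fps_const (S j * x ^ Suc j) * G (Suc j))
      + (\<Sum>j\<le>m. fps_const ((real j - real m * l) * S j * x ^ j) * G j)"
    unfolding deriv sum.distrib[symmetric]
    by (intro sum.cong refl) (simp add: distrib_left mult_ac flip: fps_const_mult)
  also have "(\<Sum>j\<le>m. fps_const ((real j - real m * l) * S j * x ^ j) * G j)
      = (\<Sum>j\<le>Suc m. fps_const ((real j - real m * l) * S j * x ^ j) * G j)"
    by (simp add: S0)
  \<comment> \<open>Reindexing by one puts both sums over the same range; the new term at j = 0 is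
    zero.\<close>
  also have "(\<Sum>j\<le>m. fps_const (S j * x ^ Suc j) * G (Suc j))
      = (\<Sum>j\<le>Suc m. fps_const ((if j = 0 then 0 else S (j - 1)) * x ^ j) * G j)"
    by (subst sum.atMost_Suc_shift) simp
  finally show ?case
    unfolding degen_Stirling2_Suc S_def[symmetric] G_def[symmetric]
    by (simp only: sum.distrib[symmetric] distrib_right fps_const_add[symmetric])
qed

lemma degen_Bell_add:
  assumes "l \<noteq> 0"
  shows "degen_Bell l (m + n) x =
    (\<Sum>j=0..m. \<Sum>k=0..n. real (n choose k) * degen_Stirling2 l m j
      * degen_ffact l (real j - real m * l) (n - k) * x ^ j * degen_Bell l k x)"
proof -
  \<comment> \<open>A product of exponential generating functions has the binomial convolution as
    its coefficients; the factors are swapped so that k indexes the Bell polynomial.\<close>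
  have coeff: "fact n * fps_nth (degen_exp l y * degen_Bell_egf l x) n
      = (\<Sum>k=0..n. real (n choose k) * degen_ffact l y (n - k) * degen_Bell l k x)" for y
  proof -
    have "fps_nth (degen_exp l y * degen_Bell_egf l x) n
        = (\<Sum>k=0..n. degen_Bell l k x / fact k * (degen_ffact l y (n - k) / fact (n - k)))"
      by (subst mult.commute) (simp add: fps_mult_nth degen_Bell_egf_nth)
    then show ?thesis
      by (simp add: sum_distrib_left binomial_fact mult_ac)
  qed
  have "degen_Bell l (m + n) x = fact n * fps_nth (fps_nth_deriv m (degen_Bell_egf l x)) n"
    by (simp add: fps_nth_fps_nth_deriv degen_Bell_egf_nth)
  also have "\<dots> = (\<Sum>j\<le>m. degen_Stirling2 l m j * x ^ j
      * (fact n * fps_nth (degen_exp l (real j - real m * l) * degen_Bell_egf l x) n))"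
    unfolding fps_nth_deriv_degen_Bell_egf[OF assms] fps_sum_nth fps_mult_left_const_nth
    by (simp add: sum_distrib_left mult_ac)
  also have "\<dots> = (\<Sum>j=0..m. \<Sum>k=0..n. real (n choose k) * degen_Stirling2 l m j
      * degen_ffact l (real j - real m * l) (n - k) * x ^ j * degen_Bell l k x)"
    unfolding coeff by (simp add: sum_distrib_left atLeast0AtMost mult_ac)
  finally show ?thesis .
qed

theorem theorem2p2:
  fixes l x :: real and m n :: nat
  assumes "l \<noteq> 0"
  shows "degen_Bell l (m + n) x =
      (\<Sum>j=0..m. \<Sum>k=0..n. real (n choose k) * degen_Stirling2 l m j
        * degen_ffact l (real j - real m * l) (n - k) * x ^ j * degen_Bell l k x)
    \<and> degen_Bell_number l (m + n) =
      (\<Sum>j=0..m. \<Sum>k=0..n. real (n choose k) * degen_Stirling2 l m j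
        * degen_ffact l (real j - real m * l) (n - k) * degen_Bell_number l k)"
  using degen_Bell_add[OF assms, of m n x] degen_Bell_add[OF assms, of m n 1]
  by (simp add: degen_Bell_number_def)

end
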